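(* Let $\Omega=[0,1]$, let $\mu,\xi>0$ be real numbers, let $\varepsilon_\nu,\varepsilon_g,I:\Omega\to\mathbb{R}$ be functions, and let $w:\Omega\to\mathbb{R}$ be a function with $w(z)\ge 0$ for all $z\in\Omega$. Assume that $I(\lambda)\ge 0$ for all $\lambda\in\Omega$. Let $\Delta z,\Delta t,\Delta\lambda>0$ be stepsizes with $N_z\Delta z=N_t\Delta t=N_\lambda\Delta\lambda=1$ for positive integers $N_z,N_t,N_\lambda$, and let $\{c_n^j\}_{n\in\mathbb{N}_0}$, $0\le j\le N_z$, be the sequences generated by the predictor-corrector scheme described in the context, with $c_0^j=1$ for all $j$. Then, independently of the values of the stepsizes $\Delta z,\Delta t,\Delta\lambda$, for every $j\in\{0,\dots,N_z\}$ the sequence $\{c_n^j\}_{n\in\mathbb{N}_0}$ is positive and non-increasing with respect to $n$; that is, $c_n^j>0$ and $c_{n+1}^j\le c_n^j$ for all $n\in\mathbb{N}_0$.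
   Context: Uniform meshes on $\Omega=[0,1]$: $z_j=j\Delta z$ for $0\le j\le N_z$, $t_n=n\Delta t$, and $\lambda_l=l\Delta\lambda$ for $0\le l\le N_\lambda$. Let $F:[0,\infty)\to[0,\infty)$ be given by $F(x)=\dfrac{2x}{x^2+1}$. The predictor-corrector scheme is the following explicit recursion. Set $c_0^j=1$ for $j=0,\dots,N_z$. For each $n=0,1,2,\dots$, given $(c_n^j)_{0\le j\le N_z}$, define for $0\le j\le N_z$ and $0\le l\le N_\lambda$ (sums over an empty index range are zero): $$\alpha_n^{j,l}=I(\lambda_l)\exp\left\{-\mu\,\Delta z\left(\varepsilon_\nu(\lambda_l)\sum_{r=0}^{j-1}c_n^r+j\,\varepsilon_g(\lambda_l)\right)\right\},$$ $$p_{n+1}^j=c_n^j\exp\left\{-\Delta t\,\Delta\lambda\,\xi\,w(z_j)\sum_{l=0}^{N_\lambda-1}F(\alpha_n^{j,l})\right\},$$ $$\beta_n^{j,l}=I(\lambda_l)\exp\left\{-\mu\frac{\Delta z}{2}\left(\varepsilon_\nu(\lambda_l)\left(c_n^0+2\sum_{r=1}^{j-1}c_n^r+c_n^j\right)+2j\,\varepsilon_g(\lambda_l)\right)\right\},$$ $$\beta_{n+1}^{j,l}=I(\lambda_l)\exp\left\{-\mu\frac{\Delta z}{2}\left(\varepsilon_\nu(\lambda_l)\left(p_{n+1}^0+2\sum_{r=1}^{j-1}p_{n+1}^r+p_{n+1}^j\right)+2j\,\varepsilon_g(\lambda_l)\right)\right\},$$ $$\gamma_{n+1}^j=F(\beta_n^{j,0})+F(\beta_{n+1}^{j,0})+2\sum_{l=1}^{N_\lambda-1}\left(F(\beta_n^{j,l})+F(\beta_{n+1}^{j,l})\right)+F(\beta_n^{j,N_\lambda})+F(\beta_{n+1}^{j,N_\lambda}),$$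 $$c_{n+1}^j=c_n^j\exp\left\{-\frac{\Delta t}{2}\,\frac{\Delta\lambda}{2}\,\xi\,w(z_j)\,\gamma_{n+1}^j\right\}.$$ Within the step from $n$ to $n+1$, the symbols $\beta_n^{j,l}$ and $\beta_{n+1}^{j,l}$ denote the two quantities just defined: the first is computed from the values $c_n^r$, the second from the predicted values $p_{n+1}^r$. They are recomputed at every step, so $\beta_{n+1}^{j,l}$ from one step is not reused as the first quantity in the next step. All quantities are real. *)

theory Defs
  imports Complex_Main
begin

text \<open>The domain of this function is \<open>[0,\<infinity>)\<close>; in the scheme it is only applied to nonnegative
  arguments.\<close>

definition F :: "real \<Rightarrow> real" where
  "F x = 2 * x / (x\<^sup>2 + 1)"

text \<open>
  The locale has no assumptions; it only collects the data of the scheme. The data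
  \<open>\<epsilon>v, \<epsilon>g, I, w\<close> are functions on \<open>[0,1]\<close>, represented by total functions whose
  values outside \<open>[0,1]\<close> are arbitrary: for \<open>j \<le> Nz\<close> the scheme evaluates them only at
  mesh points \<open>l * \<Delta>l\<close> with \<open>l \<le> Nl\<close> and \<open>r * \<Delta>z\<close> with \<open>r \<le> j\<close>. The number
  \<open>Nz\<close> is not a parameter, because the value at node \<open>j\<close> depends only on the values at
  nodes \<open>r \<le> j\<close>; values at nodes \<open>j > Nz\<close> are meaningless. \<open>\<Delta>l\<close> and \<open>Nl\<close> are the
  step size and the number of steps in the variable \<open>\<lambda>\<close>.
\<close>

locale pc_scheme =
  fixes \<mu> \<xi> :: real
    and \<epsilon>v \<epsilon>g I w :: "real \<Rightarrow> real"
    and \<Delta>z \<Delta>t \<Delta>l :: real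
    and Nl :: nat
begin

definition z :: "nat \<Rightarrow> real" where
  "z j = real j * \<Delta>z"

definition lam :: "nat \<Rightarrow> real" where
  "lam l = real l * \<Delta>l"

text \<open>In the definitions below \<open>u\<close> is the vector of nodal values \<open>j \<mapsto> c\<^sub>n\<^sup>j\<close> at the current
  time level; in \<open>beta\<close> it is either that vector or the predicted one.\<close>

definition alpha :: "(nat \<Rightarrow> real) \<Rightarrow> nat \<Rightarrow> nat \<Rightarrow> real" where
  "alpha u j l =
     I (lam l) * exp (- \<mu> * \<Delta>z * (\<epsilon>v (lam l) * (\<Sum>r<j. u r) + real j * \<epsilon>g (lam l)))"

definition predictor :: "(nat \<Rightarrow> real) \<Rightarrow> nat \<Rightarrow> real" where
  "predictor u j = u j * exp (- \<Delta>t * \<Delta>l * \<xi> * w (z j) * (\<Sum>l<Nl. F (alpha u j l)))"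

text \<open>For \<open>j = 0\<close> the inner sum is empty and the bracket is \<open>u 0 + u 0\<close>; the formula is
  used as is, without a separate case for the degenerate trapezoidal rule.\<close>

definition beta :: "(nat \<Rightarrow> real) \<Rightarrow> nat \<Rightarrow> nat \<Rightarrow> real" where
  "beta u j l =
     I (lam l) * exp (- \<mu> * (\<Delta>z / 2) *
       (\<epsilon>v (lam l) * (u 0 + 2 * (\<Sum>r=1..<j. u r) + u j) + 2 * real j * \<epsilon>g (lam l)))"

definition gamma :: "(nat \<Rightarrow> real) \<Rightarrow> nat \<Rightarrow> real" where
  "gamma u j =
     F (beta u j 0) + F (beta (predictor u) j 0)
     + 2 * (\<Sum>l=1..<Nl. F (beta u j l) + F (beta (predictor u) j l))
     + F (beta u j Nl) + F (beta (predictor u) j Nl)"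

definition corrector :: "(nat \<Rightarrow> real) \<Rightarrow> nat \<Rightarrow> real" where
  "corrector u j = u j * exp (- (\<Delta>t / 2) * (\<Delta>l / 2) * \<xi> * w (z j) * gamma u j)"

primrec c :: "nat \<Rightarrow> nat \<Rightarrow> real" where
  "c 0 = (\<lambda>j. 1)"
| "c (Suc n) = corrector (c n)"

end

end

theory Submission
  imports Defs
begin

text \<open>One step of the scheme multiplies each nodal value by an exponential, so the positivity of
  the initial values persists whatever the sign or size of the exponent (\<open>c_pos\<close>). The values do
  not increase because the exponent is nonpositive (\<open>corrector_le\<close>): it is minus a product of
  nonnegative constants, a value of \<open>w\<close> at a mesh point, and \<open>gamma\<close>, which is a sum with positive
  weights of values of \<open>F\<close> at the light intensities \<open>beta\<close> (\<open>gamma_nonneg\<close>). Each intensity is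
  nonnegative, being the value of \<open>I\<close> at a mesh point times an exponential, and \<open>F\<close> preserves
  this sign. The argument uses only signs, never magnitudes, which is why the stepsizes are
  not restricted.\<close>

lemma F_nonneg: "0 \<le> x \<Longrightarrow> 0 \<le> F x"
  by (simp add: F_def)

lemma mesh_point_in_unit_interval:
  fixes h :: real
  assumes "k \<le> N" and "0 < h" and "real N * h = 1"
  shows "real k * h \<in> {0..1}"
proof -
  have "real k * h \<le> real N * h"
    using assms(1,2) by (simp add: mult_right_mono)
  then show ?thesis using assms(2,3) by simp
qed

context pc_scheme
begin

text \<open>The nodal values enter \<open>beta\<close> only inside an exponential, so the sign of \<open>beta\<close> is that
  of \<open>I\<close> for every vector \<open>u\<close>.\<close>

lemma gamma_nonneg:
  assumes "\<And>l. l \<le> Nl \<Longrightarrow> 0 \<le> I (lam l)"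
  shows "0 \<le> gamma u j"
proof -
  \<comment> \<open>The vector \<open>v\<close> stands for both the current vector \<open>u\<close> and the predicted one.\<close>
  have "0 \<le> F (beta v j l)" if "l \<le> Nl" for v l
    by (rule F_nonneg) (simp add: beta_def assms that)
  then show ?thesis
    unfolding gamma_def by (intro add_nonneg_nonneg mult_nonneg_nonneg sum_nonneg) auto
qed

lemma corrector_pos: "0 < u j \<Longrightarrow> 0 < corrector u j"
  by (simp add: corrector_def)

lemma corrector_le:
  assumes "0 \<le> \<xi>" and "0 \<le> \<Delta>t" and "0 \<le> \<Delta>l" and "0 \<le> w (z j)"
    and "\<And>l. l \<le> Nl \<Longrightarrow> 0 \<le> I (lam l)"
    and "0 \<le> u j"
  shows "corrector u j \<le> u j"
proof -
  have "0 \<le> \<Delta>t / 2 * (\<Delta>l / 2) * \<xi> * w (z j) * gamma u j"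
    using assms(1-4) gamma_nonneg[OF assms(5)] by simp
  then have "exp (- (\<Delta>t / 2) * (\<Delta>l / 2) * \<xi> * w (z j) * gamma u j) \<le> 1"
    by simp
  then show ?thesis
    unfolding corrector_def using assms(6) by (rule mult_left_le)
qed

lemma c_pos: "0 < c n j"
  by (induction n arbitrary: j) (simp_all add: corrector_pos)

end

theorem theorem3p1:
  fixes \<mu> \<xi> :: real
    and \<epsilon>v \<epsilon>g I w :: "real \<Rightarrow> real"
    and \<Delta>z \<Delta>t \<Delta>l :: real
    and Nz Nt Nl :: nat
  assumes "\<mu> > 0" and "\<xi> > 0"
    and "\<And>x. x \<in> {0..1} \<Longrightarrow> w x \<ge> 0"
    and "\<And>x. x \<in> {0..1} \<Longrightarrow> I x \<ge> 0"
    and "\<Delta>z > 0" and "\<Delta>t > 0" and "\<Delta>l > 0"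
    and "Nz > 0" and "Nt > 0" and "Nl > 0"
    and "real Nz * \<Delta>z = 1" and "real Nt * \<Delta>t = 1" and "real Nl * \<Delta>l = 1"
  shows "let c = pc_scheme.c \<mu> \<xi> \<epsilon>v \<epsilon>g I w \<Delta>z \<Delta>t \<Delta>l Nl
         in \<forall>j\<in>{0..Nz}. \<forall>n. c n j > 0 \<and> c (Suc n) j \<le> c n j"
proof -
  interpret pc_scheme \<mu> \<xi> \<epsilon>v \<epsilon>g I w \<Delta>z \<Delta>t \<Delta>l Nl .
  have I_nonneg: "0 \<le> I (lam l)" if "l \<le> Nl" for l
    unfolding lam_def using that assms(4,7,13) mesh_point_in_unit_interval by blast
  have "c (Suc n) j \<le> c n j" if "j \<le> Nz" for n j
  proof -
    have "0 \<le> w (z j)"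
      unfolding z_def using that assms(3,5,11) mesh_point_in_unit_interval by blast
    then show ?thesis
      using assms(2,6,7) I_nonneg c_pos[of n j] by (simp add: corrector_le)
  qed
  then show ?thesis by (simp add: Let_def c_pos del: c.simps)
qed

end
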